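(* In every $4$-total coloring of a cubic graph of order $18$, the color class configuration is one of \[ (12,11,11,11),\qquad (12,12,11,10),\qquad (12,12,12,9). \] All three configurations are attained (each is the color class configuration of some $4$-total coloring of some cubic graph of order $18$). Consequently, the configurations of non-equitable $4$-total colorings of cubic graphs of order $18$ are exactly $(12,12,11,10)$ and $(12,12,12,9)$.
   Context: All graphs are finite, simple and cubic ($3$-regular), not necessarily connected. The order of a graph is its number of vertices. A $4$-total coloring of $G$ assigns one of the four colors $1,2,3,4$ to each vertex and each edge of $G$ so that adjacent vertices receive distinct colors, adjacent edges (edges sharing an endpoint) receive distinct colors, and every vertex and edge that are incident receive distinct colors. The color class $c_i$ is the set of all vertices and edges of color $i$. The color class configuration of the coloring is the multiset $\{|c_1|,|c_2|,|c_3|,|c_4|\}$, written as a non-increasing sequence. The coloring is equitable if $\bigl||c_i|-|c_j|\bigr| \le 1$ for all $i,j \in \{1,2,3,4\}$, and non-equitable otherwise. *)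

theory Defs
  imports Main "HOL-Library.Multiset"
begin

definition simple_graph :: "'a set \<Rightarrow> 'a set set \<Rightarrow> bool" where
  "simple_graph V E \<longleftrightarrow> finite V \<and> (\<forall>e\<in>E. e \<subseteq> V \<and> card e = 2)"

definition degree :: "'a set set \<Rightarrow> 'a \<Rightarrow> nat" where
  "degree E v = card {e \<in> E. v \<in> e}"

definition cubic_graph :: "'a set \<Rightarrow> 'a set set \<Rightarrow> bool" where
  "cubic_graph V E \<longleftrightarrow> simple_graph V E \<and> (\<forall>v\<in>V. degree E v = 3)"

text \<open>The elements to be coloured form the disjoint sum \<open>V <+> E\<close>: a vertex \<open>v\<close> occurs as
  \<open>Inl v\<close>, an edge \<open>e\<close> as \<open>Inr e\<close>. Values of a colouring outside \<open>V <+> E\<close> are irrelevant.\<close>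

definition total_coloring4 :: "'a set \<Rightarrow> 'a set set \<Rightarrow> ('a + 'a set \<Rightarrow> nat) \<Rightarrow> bool" where
  "total_coloring4 V E f \<longleftrightarrow>
     (\<forall>x \<in> V <+> E. f x \<in> {1..4}) \<and>
     (\<forall>u\<in>V. \<forall>v\<in>V. {u, v} \<in> E \<longrightarrow> f (Inl u) \<noteq> f (Inl v)) \<and>
     (\<forall>e\<in>E. \<forall>e'\<in>E. e \<noteq> e' \<and> e \<inter> e' \<noteq> {} \<longrightarrow> f (Inr e) \<noteq> f (Inr e')) \<and>
     (\<forall>v\<in>V. \<forall>e\<in>E. v \<in> e \<longrightarrow> f (Inl v) \<noteq> f (Inr e))"

definition color_class :: "'a set \<Rightarrow> 'a set set \<Rightarrow> ('a + 'a set \<Rightarrow> nat) \<Rightarrow> nat \<Rightarrow> ('a + 'a set) set" where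
  "color_class V E f i = {x \<in> V <+> E. f x = i}"

text \<open>The multiset of the four class sizes, listed in non-increasing order.\<close>

definition color_config :: "'a set \<Rightarrow> 'a set set \<Rightarrow> ('a + 'a set \<Rightarrow> nat) \<Rightarrow> nat list" where
  "color_config V E f =
     rev (sorted_list_of_multiset {# card (color_class V E f i). i \<in># mset_set {1..4} #})"

definition equitable :: "'a set \<Rightarrow> 'a set set \<Rightarrow> ('a + 'a set \<Rightarrow> nat) \<Rightarrow> bool" where
  "equitable V E f \<longleftrightarrow>
     (\<forall>i\<in>{1..4}. \<forall>j\<in>{1..4}.
        \<bar>int (card (color_class V E f i)) - int (card (color_class V E f j))\<bar> \<le> 1)"

end

theory Submission
  imports Defs
begin

text \<open>In a 4-total coloring of a cubic graph every color occurs exactly once at each vertex \<open>v\<close>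
  and its three edges. If \<open>a\<^sub>i\<close> vertices have color \<open>i\<close>, the edges of color \<open>i\<close> therefore form a
  perfect matching of the other vertices, so that twice the size of class \<open>i\<close> is \<open>18 + a\<^sub>i\<close>. For
  \<open>j \<noteq> i\<close>, the edges of color \<open>j\<close> match the vertices of color \<open>i\<close> to vertices of color neither \<open>i\<close>
  nor \<open>j\<close>, whence \<open>2 a\<^sub>i + a\<^sub>j \<le> 18\<close>. Summing over \<open>j\<close> gives \<open>5 a\<^sub>i \<le> 36\<close>; as the \<open>a\<^sub>i\<close> are even,
  \<open>a\<^sub>i \<le> 6\<close>, and since their sum is 18 only the three configurations remain. Each is attained by an
  explicit coloring.\<close>

section \<open>Color classes of a 4-total coloring and their sizes\<close>

definition colored_vertices :: "'a set \<Rightarrow> ('a + 'a set \<Rightarrow> nat) \<Rightarrow> nat \<Rightarrow> 'a set" where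
  "colored_vertices V f i = {v \<in> V. f (Inl v) = i}"

definition colored_edges :: "'a set set \<Rightarrow> ('a + 'a set \<Rightarrow> nat) \<Rightarrow> nat \<Rightarrow> 'a set set" where
  "colored_edges E f i = {e \<in> E. f (Inr e) = i}"

context
  fixes V :: "'a set" and E f
  assumes cubic: "cubic_graph V E" and col: "total_coloring4 V E f"
begin

lemma finite_vertices: "finite V"
  using cubic by (simp add: cubic_graph_def simple_graph_def)

lemma edgeD: "e \<in> E \<Longrightarrow> e \<subseteq> V \<and> card e = 2"
  using cubic by (simp add: cubic_graph_def simple_graph_def)

lemma finite_edges: "finite E"
  using finite_subset[of E "Pow V"] edgeD finite_vertices by auto

lemma vertex_color: "v \<in> V \<Longrightarrow> f (Inl v) \<in> {1..4}"
  using col[unfolded total_coloring4_def, THEN conjunct1] by blast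

lemma edge_color: "e \<in> E \<Longrightarrow> f (Inr e) \<in> {1..4}"
  using col[unfolded total_coloring4_def, THEN conjunct1] by blast

lemma edges_of_same_color:
  assumes "e \<in> E" "e' \<in> E" "v \<in> e" "v \<in> e'" "f (Inr e) = f (Inr e')"
  shows "e = e'"
proof (rule ccontr)
  assume "e \<noteq> e'"
  moreover have "e \<inter> e' \<noteq> {}" using assms(3,4) by blast
  ultimately show False using col assms(1,2,5) by (simp add: total_coloring4_def)
qed

lemma vertex_edge_color:
  assumes "e \<in> E" "v \<in> e"
  shows "f (Inl v) \<noteq> f (Inr e)"
proof -
  have "v \<in> V" using edgeD[OF assms(1)] assms(2) by blast
  then show ?thesis using col assms by (simp add: total_coloring4_def)
qed

lemma adjacent_color:
  assumes "{u, v} \<in> E"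
  shows "f (Inl u) \<noteq> f (Inl v)"
proof -
  have "u \<in> V" "v \<in> V" using edgeD[OF assms] by auto
  then show ?thesis using col assms by (simp add: total_coloring4_def)
qed

text \<open>By properness the three edges at \<open>v\<close> have distinct colors, all different
  from that of \<open>v\<close>. Only three such colors exist, so the inclusion is an equality by
  cardinality.\<close>

lemma colors_at_vertex:
  assumes "v \<in> V"
  shows "(\<lambda>e. f (Inr e)) ` {e \<in> E. v \<in> e} = {1..4} - {f (Inl v)}"
proof (rule card_subset_eq)
  show "(\<lambda>e. f (Inr e)) ` {e \<in> E. v \<in> e} \<subseteq> {1..4} - {f (Inl v)}"
    using edge_color vertex_edge_color by force
  have "inj_on (\<lambda>e. f (Inr e)) {e \<in> E. v \<in> e}"
    using edges_of_same_color by (auto intro!: inj_onI)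
  moreover have "card {e \<in> E. v \<in> e} = 3"
    using cubic assms by (simp add: cubic_graph_def degree_def)
  ultimately show "card ((\<lambda>e. f (Inr e)) ` {e \<in> E. v \<in> e}) = card ({1..4} - {f (Inl v)})"
    using vertex_color[OF assms] by (simp add: card_image)
qed simp

lemma ex_colored_edge:
  assumes "v \<in> V" "j \<in> {1..4}" "f (Inl v) \<noteq> j"
  obtains e where "e \<in> E" "v \<in> e" "f (Inr e) = j"
proof -
  have "j \<in> (\<lambda>e. f (Inr e)) ` {e \<in> E. v \<in> e}"
    using colors_at_vertex[OF assms(1)] assms by blast
  then show ?thesis using that by auto
qed

lemma ex_colored_neighbor:
  assumes "v \<in> V" "j \<in> {1..4}" "f (Inl v) \<noteq> j"
  shows "\<exists>u\<in>V. {v, u} \<in> E \<and> f (Inr {v, u}) = j"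
proof -
  obtain e where e: "e \<in> E" "v \<in> e" "f (Inr e) = j"
    using ex_colored_edge[OF assms] .
  then obtain u where "e = {v, u}"
    using edgeD[of e] by (auto simp: card_2_iff)
  with e show ?thesis using edgeD[of e] by auto
qed

lemma Union_colored_edges:
  assumes "i \<in> {1..4}"
  shows "\<Union>(colored_edges E f i) = V - colored_vertices V f i"
proof (intro equalityI subsetI)
  fix v assume "v \<in> \<Union>(colored_edges E f i)"
  then show "v \<in> V - colored_vertices V f i"
    using edgeD vertex_edge_color by (auto simp: colored_edges_def colored_vertices_def)
next
  fix v assume "v \<in> V - colored_vertices V f i"
  then have "v \<in> V" "f (Inl v) \<noteq> i" by (auto simp: colored_vertices_def)
  then obtain e where "e \<in> E" "v \<in> e" "f (Inr e) = i"
    using ex_colored_edge[OF _ assms] by blast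
  then show "v \<in> \<Union>(colored_edges E f i)" by (auto simp: colored_edges_def)
qed

text \<open>Edges of equal color are disjoint pairs, and by \<open>Union_colored_edges\<close>
  together they cover exactly the vertices of other colors.\<close>

lemma card_colored_edges:
  assumes "i \<in> {1..4}"
  shows "2 * card (colored_edges E f i) + card (colored_vertices V f i) = card V"
proof -
  have "2 * card (colored_edges E f i) = card (\<Union>(colored_edges E f i))"
  proof (rule card_partition)
    show "finite (colored_edges E f i)"
      using finite_edges by (simp add: colored_edges_def)
    show "finite (\<Union>(colored_edges E f i))"
      using Union_colored_edges[OF assms] finite_vertices by simp
    show "card e = 2" if "e \<in> colored_edges E f i" for e
      using that edgeD by (simp add: colored_edges_def)
    show "e \<inter> e' = {}" if "e \<in> colored_edges E f i" "e' \<in> colored_edges E f i" "e \<noteq> e'" for e e'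
      using that edges_of_same_color by (fastforce simp: colored_edges_def)
  qed
  moreover have "card (\<Union>(colored_edges E f i)) = card V - card (colored_vertices V f i)"
    unfolding Union_colored_edges[OF assms]
    using finite_vertices by (intro card_Diff_subset) (auto simp: colored_vertices_def)
  moreover have "card (colored_vertices V f i) \<le> card V"
    using finite_vertices by (intro card_mono) (auto simp: colored_vertices_def)
  ultimately show ?thesis by linarith
qed

lemma card_color_class:
  assumes "i \<in> {1..4}"
  shows "2 * card (color_class V E f i) = card V + card (colored_vertices V f i)"
proof -
  have "color_class V E f i = colored_vertices V f i <+> colored_edges E f i"
    by (auto simp: color_class_def colored_vertices_def colored_edges_def)
  then have "card (color_class V E f i) = card (colored_vertices V f i) + card (colored_edges E f i)"
    using finite_vertices finite_edges
    by (simp add: card_Plus colored_vertices_def colored_edges_def)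
  then show ?thesis using card_colored_edges[OF assms] by simp
qed

lemma sum_colored_vertices: "(\<Sum>i=1..4. card (colored_vertices V f i)) = card V"
proof -
  have "card (\<Union>i\<in>{1..4}. colored_vertices V f i) = (\<Sum>i=1..4. card (colored_vertices V f i))"
  proof (rule card_UN_disjoint)
    show "\<forall>i\<in>{1..4}. finite (colored_vertices V f i)"
      using finite_vertices unfolding colored_vertices_def by simp
    show "\<forall>i\<in>{1..4}. \<forall>j\<in>{1..4}. i \<noteq> j \<longrightarrow> colored_vertices V f i \<inter> colored_vertices V f j = {}"
      unfolding colored_vertices_def by blast
  qed simp
  moreover have "(\<Union>i\<in>{1..4}. colored_vertices V f i) = V"
    using vertex_color unfolding colored_vertices_def by blast
  ultimately show ?thesis by (simp only:)
qed

text \<open>Following the edge of color \<open>j\<close> from each vertex of color \<open>i\<close>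
  is injective. The end reached avoids color \<open>i\<close> by adjacency and color
  \<open>j\<close> by incidence, so it lies outside both vertex sets.\<close>

lemma card_two_color_classes:
  assumes "i \<in> {1..4}" "j \<in> {1..4}" "i \<noteq> j"
  shows "2 * card (colored_vertices V f i) + card (colored_vertices V f j) \<le> card V"
proof -
  let ?A = "colored_vertices V f i" and ?B = "colored_vertices V f j"
  have "\<forall>v\<in>?A. \<exists>u\<in>V. {v, u} \<in> E \<and> f (Inr {v, u}) = j"
    using ex_colored_neighbor assms by (auto simp: colored_vertices_def)
  then obtain m where m: "\<And>v. v \<in> ?A \<Longrightarrow> m v \<in> V \<and> {v, m v} \<in> E \<and> f (Inr {v, m v}) = j"
    by metis
  have "inj_on m ?A"
  proof (rule inj_onI)
    \<comment> \<open>Two edges of color \<open>j\<close> with the common end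
      \<open>m v = m w\<close> coincide, and then so do their other ends.\<close>
    fix v w assume vw: "v \<in> ?A" "w \<in> ?A" "m v = m w"
    then have "{v, m v} = {w, m v}"
      using m[of v] m[of w] edges_of_same_color[of "{v, m v}" "{w, m v}" "m v"] by simp
    then show "v = w" by (auto simp: doubleton_eq_iff)
  qed
  moreover have "m ` ?A \<subseteq> V - ?A - ?B"
  proof
    fix u assume "u \<in> m ` ?A"
    then obtain v where v: "v \<in> ?A" "u = m v" by auto
    then show "u \<in> V - ?A - ?B"
      using m[of v] adjacent_color[of v u] vertex_edge_color[of "{v, u}" u]
      by (auto simp: colored_vertices_def)
  qed
  ultimately have "card ?A \<le> card (V - ?A - ?B)"
    using finite_vertices card_inj_on_le by blast
  moreover have "card (V - ?A - ?B) + card ?B + card ?A = card V"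
  proof -
    have AB: "finite ?A" "finite ?B" "?A \<inter> ?B = {}" "?A \<union> ?B \<subseteq> V"
      using finite_vertices \<open>i \<noteq> j\<close> by (auto simp: colored_vertices_def)
    have "V - ?A - ?B = V - (?A \<union> ?B)" by auto
    then show ?thesis
      using AB card_Diff_subset[of "?A \<union> ?B" V] card_mono[OF finite_vertices AB(4)]
        card_Un_disjoint[OF AB(1-3)] by simp
  qed
  ultimately show ?thesis by simp
qed

end

section \<open>The possible configurations at order 18\<close>

lemma color_config_sort:
  "color_config V E f = rev (sort (map (\<lambda>i. card (color_class V E f i)) [1, 2, 3, 4]))"
proof -
  have "mset_set {1..4::nat} = mset [1, 2, 3, 4]"
    by (simp add: numeral_eq_Suc atLeastAtMostSuc_conv add_mset_commute)
  then have "color_config V E f =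
      rev (sorted_list_of_multiset (mset (map (\<lambda>i. card (color_class V E f i)) [1, 2, 3, 4])))"
    by (simp only: color_config_def mset_map)
  then show ?thesis by (simp only: sorted_list_of_multiset_mset)
qed

text \<open>Equitability is recorded with each configuration so that both the list of configurations
  and its non-equitable part can be read off.\<close>

lemma config_order18:
  assumes "cubic_graph V E" "total_coloring4 V E f" "card V = 18"
  shows "color_config V E f = [12, 11, 11, 11] \<and> equitable V E f \<or>
    color_config V E f \<in> {[12, 12, 11, 10], [12, 12, 12, 9]} \<and> \<not> equitable V E f"
proof -
  define n where "n i = card (color_class V E f i)" for i
  define a where "a i = card (colored_vertices V f i)" for i
  have na: "2 * n i = 18 + a i" if "i \<in> {1..4}" for i
    using card_color_class[OF assms(1,2) that] assms(3) by (simp add: n_def a_def)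
  have a2: "2 * a i + a j \<le> 18" if "i \<in> {1..4}" "j \<in> {1..4}" "i \<noteq> j" for i j
    using card_two_color_classes[OF assms(1,2) that] assms(3) by (simp add: a_def)
  have four: "{1..4::nat} = {1, 2, 3, 4}" by auto
  have sum: "a 1 + a 2 + a 3 + a 4 = 18"
    using sum_colored_vertices[OF assms(1,2)] assms(3) unfolding a_def four by simp
  note na' = na[of 1] na[of 2] na[of 3] na[of 4]
  \<comment> \<open>The lower bound is \<open>a i \<ge> 0\<close>. For the upper one, the instances
    of \<open>a2\<close> with second index other than \<open>i\<close> add up to
    \<open>5 * a i \<le> 36\<close>, so \<open>2 * n i = 18 + a i \<le> 25\<close>; parity enters
    because \<open>n i\<close> is an integer.\<close>
  have bounds: "9 \<le> n i \<and> n i \<le> 12" if "i \<in> {1..4}" for i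
    using that na' sum a2[of i 1] a2[of i 2] a2[of i 3] a2[of i 4] unfolding four by auto
  have nsum: "n 1 + n 2 + n 3 + n 4 = 45" using na' sum by simp
  have range: "n i = 9 \<or> n i = 10 \<or> n i = 11 \<or> n i = 12" if "i \<in> {1..4}" for i
    using bounds[OF that] by linarith
  have conf: "color_config V E f = rev (sort [n 1, n 2, n 3, n 4])"
    by (simp add: color_config_sort n_def)
  have equi: "equitable V E f \<longleftrightarrow>
      (\<forall>i\<in>{1, 2, 3, 4}. \<forall>j\<in>{1, 2, 3, 4}. \<bar>int (n i) - int (n j)\<bar> \<le> 1)"
    unfolding equitable_def four n_def ..
  \<comment> \<open>The deficits \<open>12 - n i\<close> are nonnegative with sum 3, so apart from
    zeros they are 3, or 2 and 1, or 1, 1 and 1. The case split runs over all values and discards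
    those with the wrong sum.\<close>
  show ?thesis
    using range[of 1, simplified] range[of 2, simplified] range[of 3, simplified]
      range[of 4, simplified] nsum
    unfolding conf equi by (elim disjE; simp)
qed

section \<open>Building colorings from systems of involutions\<close>

text \<open>Here \<open>m c v\<close> is the neighbor of \<open>v\<close> along the edge of color \<open>c\<close>, and \<open>m c v = v\<close> if \<open>v\<close>
  itself has color \<open>c\<close>.\<close>

definition mate_system :: "'a set \<Rightarrow> ('a \<Rightarrow> nat) \<Rightarrow> (nat \<Rightarrow> 'a \<Rightarrow> 'a) \<Rightarrow> bool" where
  "mate_system V k m \<longleftrightarrow> (\<forall>v\<in>V. k v \<in> {1..4} \<and> m (k v) v = v \<and>
     (\<forall>c\<in>{1..4}. m c v \<in> V \<and> m c (m c v) = v \<and> (c \<noteq> k v \<longrightarrow> k (m c v) \<noteq> k v) \<and>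
       (\<forall>d\<in>{1..4}. m c v = m d v \<longrightarrow> c = d)))"

text \<open>Each \<open>m c\<close> is an involution of \<open>V\<close> fixing exactly the vertices
  of color \<open>c\<close>; its 2-cycles become the edges of color \<open>c\<close>. Since
  different colors give different mates, every vertex has three distinct neighbors.\<close>

lemma mate_system_coloring:
  assumes "finite V" and sys: "mate_system V k m"
  obtains E f where "cubic_graph V E" "total_coloring4 V E f" "\<And>v. f (Inl v) = k v"
proof
  have k: "k v \<in> {1..4}" "m (k v) v = v" if "v \<in> V" for v
    using sys that by (auto simp: mate_system_def)
  have m: "m c v \<in> V" "m c (m c v) = v" if "v \<in> V" "c \<in> {1..4}" for c v
    using sys that by (auto simp: mate_system_def)
  have inj: "c = d" if "v \<in> V" "c \<in> {1..4}" "d \<in> {1..4}" "m c v = m d v" for c d v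
    using sys that unfolding mate_system_def by blast
  have k_mate: "k (m c v) \<noteq> k v" if "v \<in> V" "c \<in> {1..4}" "c \<noteq> k v" for c v
    using sys that by (auto simp: mate_system_def)
  have fix_iff: "m c v = v \<longleftrightarrow> c = k v" if "v \<in> V" "c \<in> {1..4}" for c v
    using inj[of v c "k v"] k[of v] that by auto
  define E where "E = {{v, m c v} |v c. v \<in> V \<and> c \<in> {1..4} \<and> c \<noteq> k v}"
  define P where "P e c \<longleftrightarrow> c \<in> {1..4} \<and> (\<exists>v\<in>V. c \<noteq> k v \<and> e = {v, m c v})" for e c
  \<comment> \<open>An edge arises from either of its ends, so its color is chosen through
    \<open>P\<close>; \<open>f_edge\<close> shows that the choice fits at both ends.\<close>
  define f where "f = case_sum k (\<lambda>e. SOME c. P e c)"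
  show fk: "f (Inl v) = k v" for v by (simp add: f_def)
  have f_edge: "f (Inr e) \<in> {1..4} \<and> f (Inr e) \<noteq> k v \<and> e = {v, m (f (Inr e)) v}"
    if "e \<in> E" "v \<in> e" for e v
  proof -
    have "\<exists>c. P e c" using \<open>e \<in> E\<close> by (auto simp: E_def P_def)
    then have "P e (f (Inr e))" by (auto simp: f_def intro: someI)
    then obtain u where u: "u \<in> V" "f (Inr e) \<in> {1..4}" "f (Inr e) \<noteq> k u"
        "e = {u, m (f (Inr e)) u}"
      by (auto simp: P_def)
    then consider "v = u" | "v = m (f (Inr e)) u" using \<open>v \<in> e\<close> by blast
    then show ?thesis
    proof cases
      case 1
      then show ?thesis using u by simp
    next
      case 2
      \<comment> \<open>From its other end the edge looks the same: the involution leads back to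
        \<open>u\<close>, and \<open>v\<close> is no fixed point, hence not of the edge's
        color.\<close>
      then have "v \<in> V" "m (f (Inr e)) v = u" "u \<noteq> v"
        using u m[of u "f (Inr e)"] fix_iff[of u "f (Inr e)"] by auto
      then show ?thesis using u 2 fix_iff[of v "f (Inr e)"] by auto
    qed
  qed
  have EV: "e \<subseteq> V" if "e \<in> E" for e
    using that m by (auto simp: E_def)
  have at_vertex: "{e \<in> E. v \<in> e} = (\<lambda>c. {v, m c v}) ` ({1..4} - {k v})" if "v \<in> V" for v
  proof (intro equalityI subsetI)
    fix e assume "e \<in> {e \<in> E. v \<in> e}"
    then show "e \<in> (\<lambda>c. {v, m c v}) ` ({1..4} - {k v})"
      using f_edge[of e v] by blast
  qed (use that in \<open>unfold E_def, blast\<close>)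
  show "cubic_graph V E"
    unfolding cubic_graph_def simple_graph_def
  proof (intro conjI ballI)
    fix e assume "e \<in> E"
    then obtain v c where "v \<in> V" "c \<in> {1..4}" "c \<noteq> k v" "e = {v, m c v}"
      by (auto simp: E_def)
    then show "card e = 2" using fix_iff[of v c] by (auto simp: card_2_iff)
  next
    fix v assume v: "v \<in> V"
    have "inj_on (\<lambda>c. {v, m c v}) ({1..4} - {k v})"
      using inj[OF v] by (auto simp: inj_on_def doubleton_eq_iff)
    then show "degree E v = 3"
      using k[OF v] by (simp add: degree_def at_vertex[OF v] card_image)
  qed (use assms(1) EV in auto)
  show "total_coloring4 V E f"
    unfolding total_coloring4_def
  proof (intro conjI ballI impI)
    fix x assume "x \<in> V <+> E"
    then show "f x \<in> {1..4}"
    proof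
      fix e assume "x = Inr e" "e \<in> E"
      then have "e \<noteq> {}" by (auto simp: E_def)
      then show "f x \<in> {1..4}" using f_edge \<open>x = Inr e\<close> \<open>e \<in> E\<close> by blast
    qed (use k fk in auto)
  next
    fix u v assume "u \<in> V" "v \<in> V" "{u, v} \<in> E"
    define c where "c = f (Inr {u, v})"
    have c: "c \<in> {1..4}" "c \<noteq> k u" "{u, v} = {u, m c u}"
      using f_edge[OF \<open>{u, v} \<in> E\<close>, of u] by (auto simp: c_def)
    then have "v = m c u" by (auto simp: doubleton_eq_iff)
    then show "f (Inl u) \<noteq> f (Inl v)"
      using k_mate[OF \<open>u \<in> V\<close> c(1,2)] fk by simp
  next
    fix e e' assume "e \<in> E" "e' \<in> E" "e \<noteq> e' \<and> e \<inter> e' \<noteq> {}"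
    \<comment> \<open>At a common end \<open>v\<close>, two edges of the same color \<open>c\<close>
      would both be \<open>{v, m c v}\<close>.\<close>
    then show "f (Inr e) \<noteq> f (Inr e')"
      using f_edge by (metis disjoint_iff)
  next
    fix v e assume "v \<in> V" "e \<in> E" "v \<in> e"
    then show "f (Inl v) \<noteq> f (Inr e)" using f_edge fk by metis
  qed
qed

text \<open>The color of \<open>v\<close> is \<open>ks ! v\<close>, and row \<open>c - 1\<close> of \<open>ms\<close> lists the mates along color \<open>c\<close>.\<close>

lemma mate_table_config:
  assumes "mate_system (set [0..<18]) ((!) ks) (\<lambda>c. (!) (ms ! (c - 1)))"
    and "map (\<lambda>i. length (filter (\<lambda>v. ks ! v = i) [0..<18])) [1, 2, 3, 4] =
      map (\<lambda>x. 2 * x - 18) xs"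
    and "\<forall>x\<in>set xs. 9 \<le> x"
  shows "\<exists>(V :: nat set) E f. cubic_graph V E \<and> card V = 18 \<and> total_coloring4 V E f \<and>
    color_config V E f = rev (sort xs)"
proof -
  let ?V = "set [0..<18] :: nat set"
  obtain E f where Ef: "cubic_graph ?V E" "total_coloring4 ?V E f" "\<And>v. f (Inl v) = ks ! v"
    using mate_system_coloring[OF _ assms(1)] by blast
  have "colored_vertices ?V f i = set (filter (\<lambda>v. ks ! v = i) [0..<18])" for i
    by (auto simp: colored_vertices_def Ef(3))
  then have "card (colored_vertices ?V f i) = length (filter (\<lambda>v. ks ! v = i) [0..<18])" for i
    using distinct_card[OF distinct_filter[OF distinct_upt]] by metis
  then have "2 * card (color_class ?V E f i) = 18 + length (filter (\<lambda>v. ks ! v = i) [0..<18])"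
    if "i \<in> {1..4}" for i
    using card_color_class[OF Ef(1,2) that] by simp
  then have cc: "card (color_class ?V E f i) = (18 + length (filter (\<lambda>v. ks ! v = i) [0..<18])) div 2"
    if "i \<in> {1..4}" for i
    using that by (metis nonzero_mult_div_cancel_left zero_neq_numeral)
  have "map (\<lambda>i. card (color_class ?V E f i)) [1, 2, 3, 4] =
      map (\<lambda>n. (18 + n) div 2) (map (\<lambda>i. length (filter (\<lambda>v. ks ! v = i) [0..<18])) [1, 2, 3, 4])"
    using cc[of 1] cc[of 2] cc[of 3] cc[of 4] by (simp del: set_upt)
  \<comment> \<open>Subtraction on \<open>nat\<close> truncates; \<open>9 \<le> x\<close> ensures
    that halving \<open>18 + (2 * x - 18)\<close> gives back \<open>x\<close>.\<close>
  also have "\<dots> = xs"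
    unfolding assms(2) using assms(3) by (auto intro!: map_idI)
  finally have "color_config ?V E f = rev (sort xs)"
    by (simp add: color_config_sort)
  moreover have "card ?V = 18" by simp
  ultimately show ?thesis using Ef by blast
qed

section \<open>Explicit colorings attaining the three configurations\<close>

lemma config_12_11_11_11:
  "\<exists>(V :: nat set) E f. cubic_graph V E \<and> card V = 18 \<and> total_coloring4 V E f \<and>
    color_config V E f = [12, 11, 11, 11]"
proof -
  \<comment> \<open>The vertex counts are 6, 4, 4, 4.\<close>
  let ?ks = "[1, 1, 1, 1, 1, 1, 2, 2, 2, 2, 3, 3, 3, 3, 4, 4, 4, 4] :: nat list"
  let ?ms = "[[0, 1, 2, 3, 4, 5, 13, 12, 17, 14, 16, 15, 7, 6, 9, 11, 10, 8],
    [15, 14, 13, 11, 10, 16, 6, 7, 8, 9, 4, 3, 17, 2, 1, 0, 5, 12],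
    [16, 6, 9, 8, 15, 14, 1, 17, 3, 2, 10, 11, 12, 13, 5, 4, 0, 7],
    [11, 7, 10, 9, 12, 6, 5, 1, 13, 3, 2, 0, 4, 8, 14, 15, 16, 17]] :: nat list list"
  have "mate_system (set [0..<18]) ((!) ?ks) (\<lambda>c. (!) (?ms ! (c - 1)))"
    unfolding mate_system_def by code_simp
  from mate_table_config[OF this, of "[12, 11, 11, 11]"] show ?thesis
    by (simp add: upt_rec)
qed

lemma config_12_12_11_10:
  "\<exists>(V :: nat set) E f. cubic_graph V E \<and> card V = 18 \<and> total_coloring4 V E f \<and>
    color_config V E f = [12, 12, 11, 10]"
proof -
  \<comment> \<open>The vertex counts are 6, 6, 4, 2.\<close>
  let ?ks = "[1, 1, 1, 1, 1, 1, 2, 2, 2, 2, 2, 2, 3, 3, 3, 3, 4, 4] :: nat list"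
  let ?ms = "[[0, 1, 2, 3, 4, 5, 12, 13, 17, 16, 15, 14, 6, 7, 11, 10, 9, 8],
    [14, 13, 16, 17, 15, 12, 6, 7, 8, 9, 10, 11, 5, 1, 0, 4, 2, 3],
    [11, 6, 8, 7, 16, 10, 1, 3, 2, 17, 5, 0, 12, 13, 14, 15, 4, 9],
    [8, 14, 7, 6, 10, 13, 3, 2, 0, 15, 4, 12, 11, 5, 1, 9, 16, 17]] :: nat list list"
  have "mate_system (set [0..<18]) ((!) ?ks) (\<lambda>c. (!) (?ms ! (c - 1)))"
    unfolding mate_system_def by code_simp
  from mate_table_config[OF this, of "[12, 12, 11, 10]"] show ?thesis
    by (simp add: upt_rec)
qed

lemma config_12_12_12_9:
  "\<exists>(V :: nat set) E f. cubic_graph V E \<and> card V = 18 \<and> total_coloring4 V E f \<and>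
    color_config V E f = [12, 12, 12, 9]"
proof -
  \<comment> \<open>The vertex counts are 6, 6, 6, 0: no vertex has color 4, so the last row of
    \<open>?ms\<close> has no fixed point and its edges form a perfect matching of the whole
    graph.\<close>
  let ?ks = "[1, 1, 1, 1, 1, 1, 2, 2, 2, 2, 2, 2, 3, 3, 3, 3, 3, 3] :: nat list"
  let ?ms = "[[0, 1, 2, 3, 4, 5, 12, 17, 13, 15, 14, 16, 6, 8, 10, 9, 11, 7],
    [16, 14, 12, 17, 13, 15, 6, 7, 8, 9, 10, 11, 2, 4, 1, 5, 0, 3],
    [11, 6, 9, 7, 8, 10, 1, 3, 4, 2, 5, 0, 12, 13, 14, 15, 16, 17],
    [17, 7, 13, 9, 10, 16, 15, 1, 12, 3, 4, 14, 8, 2, 11, 6, 5, 0]] :: nat list list"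
  have "mate_system (set [0..<18]) ((!) ?ks) (\<lambda>c. (!) (?ms ! (c - 1)))"
    unfolding mate_system_def by code_simp
  from mate_table_config[OF this, of "[12, 12, 12, 9]"] show ?thesis
    by (simp add: upt_rec)
qed

theorem theorem5p4:
  "(\<forall>(V :: 'a set) E f. cubic_graph V E \<and> card V = 18 \<and> total_coloring4 V E f \<longrightarrow>
       color_config V E f \<in> {[12, 11, 11, 11], [12, 12, 11, 10], [12, 12, 12, 9]}) \<and>
   (\<forall>c \<in> {[12, 11, 11, 11], [12, 12, 11, 10], [12, 12, 12, 9]}.
       \<exists>(V :: nat set) E f. cubic_graph V E \<and> card V = 18 \<and> total_coloring4 V E f \<and>
         color_config V E f = c) \<and>
   {color_config V E f | (V :: nat set) E f.
       cubic_graph V E \<and> card V = 18 \<and> total_coloring4 V E f \<and> \<not> equitable V E f}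
     = {[12, 12, 11, 10], [12, 12, 12, 9]}" (is "?configs \<and> ?attained \<and> ?S = ?T")
proof (intro conjI)
  show ?configs using config_order18 by blast
  show attained: ?attained
    using config_12_11_11_11 config_12_12_11_10 config_12_12_12_9 by simp
  show "?S = ?T"
  proof (intro equalityI subsetI)
    fix c assume "c \<in> ?S"
    then show "c \<in> ?T" using config_order18 by blast
  next
    fix c assume c: "c \<in> ?T"
    then obtain V :: "nat set" and E f where
      "cubic_graph V E" "card V = 18" "total_coloring4 V E f" "color_config V E f = c"
      using attained by blast
    \<comment> \<open>By \<open>config_order18\<close> an equitable coloring would have
      configuration \<open>[12, 11, 11, 11]\<close>, which is not in \<open>?T\<close>.\<close>
    moreover from this have "\<not> equitable V E f"
      using config_order18[of V E f] c by auto
    ultimately show "c \<in> ?S" by blast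
  qed
qed

end
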